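(* Let $\mathfrak g=\mathfrak g_-\oplus\mathfrak g_0=\mathfrak g_{-k}\oplus\cdots\oplus\mathfrak g_0$ be a non-positively graded fundamental Lie algebra with a Euclidean metric $\langle\cdot,\cdot\rangle_{\mathfrak g}$ adapted to the gradation, and let $\langle\cdot,\cdot\rangle$ be the metric on $\mathfrak h=t^*(\mathfrak g)=\mathfrak g\oplus\mathfrak g^*$ which coincides with $\langle\cdot,\cdot\rangle_{\mathfrak g}$ on $\mathfrak g$, with the induced metric $\langle\cdot,\cdot\rangle_{\mathfrak g^*}$ on $\mathfrak g^*$, and for which $\mathfrak g$ is orthogonal to $\mathfrak g^*$. Suppose $\langle\cdot,\cdot\rangle$ is admissible. Then $\mathfrak g_0$ is abelian and $\langle\cdot,\cdot\rangle_{\mathfrak g}$ is not $\mathrm{Ad}_{G_0}$-invariant.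
   Context: Lie algebras are real and finite dimensional. Fundamental gradation of $\mathfrak g$: $[\mathfrak g_i,\mathfrak g_j]\subset\mathfrak g_{i+j}$ ($\mathfrak g_i=0$ for $i<-k$ or $i>0$), $k>0$, $\mathfrak g_-=\mathfrak g_{-k}\oplus\cdots\oplus\mathfrak g_{-1}$ is generated by $\mathfrak g_{-1}$, $\mathfrak g_0$ and $\mathfrak g_{-k}$ are non-trivial, and the adjoint action of $\mathfrak g_0$ on $\mathfrak g_{-1}$ is exact (faithful). A Euclidean metric is adapted to the gradation if different graded components are orthogonal. $G_0$ is a connected Lie group with Lie algebra $\mathfrak g_0$, acting on $\mathfrak g$ by the adjoint action (so $\mathrm{Ad}_{G_0}$-invariance of $\langle\cdot,\cdot\rangle_{\mathfrak g}$ is equivalent to skew-symmetry of $\mathrm{ad}_X:\mathfrak g\to\mathfrak g$ for all $X\in\mathfrak g_0$). For $X\in\mathfrak g$, $L_X(\alpha)(Y)=-\alpha([X,Y])$ is the coadjoint action on $\mathfrak g^*$. The cotangent Lie algebra is $\mathfrak h=t^*(\mathfrak g)=\mathfrak g\oplus\mathfrak g^*$ with bracket $[X+\xi,Y+\eta]=[X,Y]+L_X(\eta)-L_Y(\xi)$; its gradation is $\mathfrak h_i=\mathfrak g_i$ ($i<0$), $\mathfrak h_0=\mathfrak g_0\oplus(\mathfrak g_0)^*$, $\mathfrak h_i=(\mathfrak g_{-i})^*$ ($i>0$). So $\mathfrak h_-=\mathfrak g_-$ and $\mathfrak q:=\mathfrak h_0\oplus\mathfrak h_+=\mathfrak g_0\oplus\mathfrak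 g^*$. $H$ is a connected Lie group with Lie algebra $\mathfrak h$ and $Q$ its connected subgroup with Lie algebra $\mathfrak q$. Admissibility. $C^p(\mathfrak h_-,\mathfrak h)=\Lambda^p(\mathfrak h_-^* )\otimes\mathfrak h$, with Lie algebra differential $$(\partial\phi)(X_0,\dots,X_p)=\sum_i(-1)^i[X_i,\phi(\dots,\widehat{X_i},\dots)]+\sum_{i<j}(-1)^{i+j}\phi([X_i,X_j],\dots,\widehat{X_i},\dots,\widehat{X_j},\dots);$$ $\partial^*$ is its metric adjoint with respect to the metrics naturally induced on the spaces $C^p(\mathfrak h_-,\mathfrak h)$. $Q$ acts on $\mathfrak h_-\cong\mathfrak h/\mathfrak q$ by the action $\mathrm{Ad}^-$ induced by the adjoint action, and on $C^p(\mathfrak h_-,\mathfrak h)$ by $(g\cdot\phi)(X_1,\dots,X_p)=\mathrm{Ad}_g(\phi(\mathrm{Ad}^-_{g^{-1}}X_1,\dots,\mathrm{Ad}^-_{g^{-1}}X_p))$. The metric is admissible if $\partial^*:C^{p+1}(\mathfrak h_-,\mathfrak h)\to C^p(\mathfrak h_-,\mathfrak h)$ is $Q$-invariant (commutes with the $Q$-actions) for every $p\ge0$. *)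

theory Defs
  imports "HOL-Analysis.Analysis"
begin

definition lie_algebra :: "('v::real_vector \<Rightarrow> 'v \<Rightarrow> 'v) \<Rightarrow> bool" where
  "lie_algebra br \<longleftrightarrow> bilinear br \<and> (\<forall>x. br x x = 0) \<and>
     (\<forall>x y z. br x (br y z) + br y (br z x) + br z (br x y) = 0)"

definition lie_subalgebra :: "('v::real_vector \<Rightarrow> 'v \<Rightarrow> 'v) \<Rightarrow> 'v set \<Rightarrow> bool" where
  "lie_subalgebra br S \<longleftrightarrow> subspace S \<and> (\<forall>x\<in>S. \<forall>y\<in>S. br x y \<in> S)"

definition neg_part :: "(int \<Rightarrow> 'v::real_vector set) \<Rightarrow> 'v set" where
  "neg_part V = span (\<Union>i\<in>{..<0}. V i)"

definition nonneg_part :: "(int \<Rightarrow> 'v::real_vector set) \<Rightarrow> 'v set" where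
  "nonneg_part V = span (\<Union>i\<in>{0..}. V i)"

text \<open>The second and third conjuncts together say that the whole space is the direct sum
  of the components of degrees between \<open>-k\<close> and \<open>0\<close>.\<close>

definition fundamental_gradation ::
    "('v::real_vector \<Rightarrow> 'v \<Rightarrow> 'v) \<Rightarrow> nat \<Rightarrow> (int \<Rightarrow> 'v set) \<Rightarrow> bool" where
  "fundamental_gradation br k V \<longleftrightarrow>
     (\<forall>i. subspace (V i)) \<and>
     (\<forall>i. i < - int k \<or> i > 0 \<longrightarrow> V i = {0}) \<and>
     (\<forall>x. \<exists>!f. (\<forall>i. f i \<in> V i) \<and> x = (\<Sum>i = - int k..0. f i)) \<and>
     (\<forall>i j. \<forall>x\<in>V i. \<forall>y\<in>V j. br x y \<in> V (i + j)) \<and>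
     k > 0 \<and>
     lie_subalgebra br hull V (-1) = neg_part V \<and>
     V 0 \<noteq> {0} \<and> V (- int k) \<noteq> {0} \<and>
     (\<forall>x\<in>V 0. (\<forall>y\<in>V (-1). br x y = 0) \<longrightarrow> x = 0)"

definition adapted_metric ::
    "('v \<Rightarrow> 'v \<Rightarrow> real) \<Rightarrow> (int \<Rightarrow> 'v set) \<Rightarrow> bool" where
  "adapted_metric ip V \<longleftrightarrow>
     (\<forall>i j. i \<noteq> j \<longrightarrow> (\<forall>x\<in>V i. \<forall>y\<in>V j. ip x y = 0))"

definition endo_exp :: "('v::real_normed_vector \<Rightarrow> 'v) \<Rightarrow> 'v \<Rightarrow> 'v" where
  "endo_exp A x = (\<Sum>n. (A ^^ n) x /\<^sub>R fact n)"

text \<open>If \<open>H\<close> is a connected Lie group with Lie algebra \<open>\<hh>\<close>, its connected Lie subgroup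
  with Lie algebra \<open>S\<close> is generated by the elements \<open>exp X\<close> for \<open>X \<in> S\<close>, and
  \<open>Ad (exp X)\<close> is the exponential of \<open>ad X\<close>.  Hence the image of that subgroup under
  \<open>Ad\<close> is the set below, whatever \<open>H\<close> is.  It is closed under inverses
  because \<open>-X \<in> S\<close> whenever \<open>X \<in> S\<close>.\<close>

inductive_set adjoint_group ::
    "('v::real_normed_vector \<Rightarrow> 'v \<Rightarrow> 'v) \<Rightarrow> 'v set \<Rightarrow> ('v \<Rightarrow> 'v) set"
  for br :: "'v \<Rightarrow> 'v \<Rightarrow> 'v" and S :: "'v set" where
  adjoint_group_id: "id \<in> adjoint_group br S"
| adjoint_group_step:
    "A \<in> adjoint_group br S \<Longrightarrow> X \<in> S \<Longrightarrow> endo_exp (br X) \<circ> A \<in> adjoint_group br S"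

definition Ad_invariant_metric ::
    "('v::real_normed_vector \<Rightarrow> 'v \<Rightarrow> 'v) \<Rightarrow> 'v set \<Rightarrow> ('v \<Rightarrow> 'v \<Rightarrow> real) \<Rightarrow> bool" where
  "Ad_invariant_metric br S ip \<longleftrightarrow>
     (\<forall>A\<in>adjoint_group br S. \<forall>x y. ip (A x) (A y) = ip x y)"

text \<open>A \<open>p\<close>-cochain on the subspace \<open>M\<close> is an alternating multilinear map on \<open>M\<^sup>p\<close> with
  values in the whole space.  Argument tuples are lists of length \<open>p\<close>, and a cochain is
  required to vanish on all other lists, so that cochains are equal as functions
  exactly when they agree on \<open>M\<^sup>p\<close>.\<close>

definition tuples :: "'v set \<Rightarrow> nat \<Rightarrow> 'v list set" where
  "tuples M p = {xs. set xs \<subseteq> M \<and> length xs = p}"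

definition cochains :: "'v::real_vector set \<Rightarrow> nat \<Rightarrow> ('v list \<Rightarrow> 'v) set" where
  "cochains M p = {\<phi>.
     (\<forall>xs\<in>tuples M p. \<forall>i<p. \<forall>x\<in>M. \<forall>y\<in>M. \<forall>a b.
        \<phi> (xs[i := a *\<^sub>R x + b *\<^sub>R y]) = a *\<^sub>R \<phi> (xs[i := x]) + b *\<^sub>R \<phi> (xs[i := y])) \<and>
     (\<forall>xs\<in>tuples M p. \<forall>j<p. \<forall>i<j. xs ! i = xs ! j \<longrightarrow> \<phi> xs = 0) \<and>
     (\<forall>xs. xs \<notin> tuples M p \<longrightarrow> \<phi> xs = 0)}"

text \<open>\<open>nths xs (- I)\<close> is the list \<open>xs\<close> with the entries at the positions in \<open>I\<close> omitted.\<close>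

definition differential ::
    "('v::real_vector \<Rightarrow> 'v \<Rightarrow> 'v) \<Rightarrow> 'v set \<Rightarrow> nat \<Rightarrow> ('v list \<Rightarrow> 'v) \<Rightarrow> 'v list \<Rightarrow> 'v" where
  "differential br M p \<phi> xs =
     (if xs \<in> tuples M (Suc p) then
        (\<Sum>i\<le>p. (-1) ^ i *\<^sub>R br (xs ! i) (\<phi> (nths xs (- {i})))) +
        (\<Sum>j\<le>p. \<Sum>i<j. (-1) ^ (i + j) *\<^sub>R \<phi> (br (xs ! i) (xs ! j) # nths xs (- {i, j})))
      else 0)"

definition orthonormal_basis_of ::
    "('v::real_vector \<Rightarrow> 'v \<Rightarrow> real) \<Rightarrow> 'v set \<Rightarrow> 'v set \<Rightarrow> bool" where
  "orthonormal_basis_of ip M B \<longleftrightarrow>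
     finite B \<and> span B = M \<and> (\<forall>b\<in>B. \<forall>c\<in>B. ip b c = (if b = c then 1 else 0))"

text \<open>The metric on \<open>p\<close>-cochains induced by a metric on the whole space.  For alternating maps
  the sum over all \<open>p\<close>-tuples of basis vectors, divided by \<open>p!\<close>, is the sum over
  the increasing ones.  The value does not depend on the chosen orthonormal basis.\<close>

definition cochain_inner ::
    "('v::real_vector \<Rightarrow> 'v \<Rightarrow> real) \<Rightarrow> 'v set \<Rightarrow> nat \<Rightarrow>
     ('v list \<Rightarrow> 'v) \<Rightarrow> ('v list \<Rightarrow> 'v) \<Rightarrow> real" where
  "cochain_inner ip M p \<phi> \<psi> =
     (\<Sum>xs\<in>tuples (SOME B. orthonormal_basis_of ip M B) p. ip (\<phi> xs) (\<psi> xs)) / fact p"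

text \<open>The metric adjoint of the differential from \<open>p\<close>-cochains to \<open>(p+1)\<close>-cochains.\<close>

definition codifferential ::
    "('v::real_vector \<Rightarrow> 'v \<Rightarrow> 'v) \<Rightarrow> ('v \<Rightarrow> 'v \<Rightarrow> real) \<Rightarrow> 'v set \<Rightarrow> nat \<Rightarrow>
     ('v list \<Rightarrow> 'v) \<Rightarrow> 'v list \<Rightarrow> 'v" where
  "codifferential br ip M p \<psi> =
     (THE \<eta>. \<eta> \<in> cochains M p \<and>
        (\<forall>\<phi>\<in>cochains M p.
           cochain_inner ip M (Suc p) (differential br M p \<phi>) \<psi> = cochain_inner ip M p \<phi> \<eta>))"

definition proj_along :: "'v::real_vector set \<Rightarrow> 'v set \<Rightarrow> 'v \<Rightarrow> 'v" where
  "proj_along M N x = (THE y. y \<in> M \<and> x - y \<in> N)"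

text \<open>For \<open>A = Ad g\<close>, the map \<open>X \<mapsto> proj_along M N (A X)\<close> on \<open>M\<close> is the action of \<open>g\<close>
  on the quotient by \<open>N\<close>, transported to the complement \<open>M\<close>; for \<open>g\<inverse>\<close> one
  replaces \<open>A\<close> by \<open>inv A\<close>.\<close>

definition cochain_action ::
    "'v::real_vector set \<Rightarrow> 'v set \<Rightarrow> nat \<Rightarrow> ('v \<Rightarrow> 'v) \<Rightarrow>
     ('v list \<Rightarrow> 'v) \<Rightarrow> 'v list \<Rightarrow> 'v" where
  "cochain_action M N p A \<phi> xs =
     (if xs \<in> tuples M p then A (\<phi> (map (\<lambda>X. proj_along M N (inv A X)) xs)) else 0)"

definition admissible_metric ::
    "('v::real_normed_vector \<Rightarrow> 'v \<Rightarrow> 'v) \<Rightarrow> (int \<Rightarrow> 'v set) \<Rightarrow> ('v \<Rightarrow> 'v \<Rightarrow> real) \<Rightarrow> bool" where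
  "admissible_metric br V ip \<longleftrightarrow>
     (let M = neg_part V; N = nonneg_part V in
      \<forall>p. \<forall>A\<in>adjoint_group br N. \<forall>\<psi>\<in>cochains M (Suc p).
        codifferential br ip M p (cochain_action M N (Suc p) A \<psi>) =
        cochain_action M N p A (codifferential br ip M p \<psi>))"

text \<open>On a Euclidean space every linear functional is bounded, so the dual space is the
  type of bounded linear functionals.\<close>

type_synonym 'a dual = "'a \<Rightarrow>\<^sub>L real"

definition coadjoint ::
    "('a::euclidean_space \<Rightarrow> 'a \<Rightarrow> 'a) \<Rightarrow> 'a \<Rightarrow> 'a dual \<Rightarrow> 'a dual" where
  "coadjoint br X \<alpha> = Blinfun (\<lambda>Y. - blinfun_apply \<alpha> (br X Y))"

definition cot_bracket ::
    "('a::euclidean_space \<Rightarrow> 'a \<Rightarrow> 'a) \<Rightarrow> 'a \<times> 'a dual \<Rightarrow> 'a \<times> 'a dual \<Rightarrow> 'a \<times> 'a dual" where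
  "cot_bracket br u v =
     (br (fst u) (fst v), coadjoint br (fst u) (snd v) - coadjoint br (fst v) (snd u))"

text \<open>The dual of \<open>V i\<close>, as the subspace of functionals vanishing on the other components.\<close>

definition dual_component ::
    "(int \<Rightarrow> 'a::euclidean_space set) \<Rightarrow> int \<Rightarrow> 'a dual set" where
  "dual_component V i = {\<alpha>. \<forall>j. j \<noteq> i \<longrightarrow> (\<forall>x\<in>V j. blinfun_apply \<alpha> x = 0)}"

definition cot_gradation ::
    "(int \<Rightarrow> 'a::euclidean_space set) \<Rightarrow> int \<Rightarrow> ('a \<times> 'a dual) set" where
  "cot_gradation V i =
     (if i < 0 then V i \<times> {0}
      else if i = 0 then V 0 \<times> dual_component V 0
      else {0} \<times> dual_component V (- i))"

definition dual_inner :: "'a::euclidean_space dual \<Rightarrow> 'a dual \<Rightarrow> real" where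
  "dual_inner \<alpha> \<beta> = (\<Sum>b\<in>Basis. blinfun_apply \<alpha> b * blinfun_apply \<beta> b)"

definition cot_inner ::
    "'a::euclidean_space \<times> 'a dual \<Rightarrow> 'a \<times> 'a dual \<Rightarrow> real" where
  "cot_inner u v = fst u \<bullet> fst v + dual_inner (snd u) (snd v)"

end

theory Submission
  imports Defs
begin

text \<open>
  The idea is to test admissibility at \<open>p = 0\<close> on the elements \<open>Ad (exp \<alpha>)\<close> of \<open>Q\<close>
  with \<open>\<alpha>\<close> in the dual space. There \<open>ad \<alpha>\<close> maps the Lie algebra \<open>\<gg>\<close> to its dual and kills the
  dual, so \<open>Ad (exp \<alpha>) = 1 + ad \<alpha>\<close> exactly, and it acts trivially on \<open>\<hh> / \<qq>\<close>. Since
  \<open>\<partial>\<^sup>* \<psi> = (\<Sum>b. (ad b)\<^sup>* (\<psi> b))\<close> on 1-cochains, for an orthonormal basis \<open>b\<close> of the negative part,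
  invariance of \<open>\<partial>\<^sup>*\<close> says that \<open>ad \<alpha>\<close> commutes with \<open>(ad e)\<^sup>*\<close> for every negative \<open>e\<close>
  (\<open>admissible_commutes_with_adjoint\<close>). Writing \<open>T e\<close> for the metric adjoint of \<open>ad e\<close>
  on \<open>\<gg>\<close> and identifying \<open>\<gg>\<close> with its dual through the metric, this becomes
  \<open>[T e x, y] + [x, T e y] = 0\<close> for all \<open>x\<close> and \<open>y\<close> (\<open>admissible_imp_adjoint_identity\<close>).

  Let \<open>e\<close> have degree \<open>-1\<close>, so that \<open>T e\<close> raises degrees by one and kills degree 0. The
  identity then shows that degree 0 centralises all \<open>T e y\<close> with \<open>y\<close> of degree \<open>-1\<close>. These span
  degree 0, because a vector of degree 0 orthogonal to all of them commutes with
  degree \<open>-1\<close> and vanishes by faithfulness. Hence degree 0 is abelian.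

  If the metric were invariant, each \<open>ad W\<close> with \<open>W\<close> of degree 0 would be skew
  (\<open>Ad_invariant_metric_imp_skew\<close>), which means \<open>T e x = - T x e\<close> in degree \<open>-1\<close>. The trilinear
  map \<open>[T e x, y]\<close> on degree \<open>-1\<close> would be antisymmetric in \<open>e\<close> and \<open>x\<close>, and it is symmetric in \<open>x\<close>
  and \<open>y\<close> by the identity. Such a map is zero, so faithfulness gives
  \<open>T e x = 0\<close>, hence \<open>[e, W] = 0\<close>, hence \<open>W = 0\<close>, contradicting that degree 0 is non-trivial.
\<close>

section \<open>The codifferential on 1-cochains\<close>

lemma tuples_1: "tuples S (Suc 0) = (\<lambda>b. [b]) ` S"
  by (auto simp: tuples_def length_Suc_conv)

lemma tuples_0: "tuples S 0 = {[]}"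
  by (auto simp: tuples_def)

lemma cochain_inner_0: "cochain_inner ip M 0 \<phi> \<psi> = ip (\<phi> []) (\<psi> [])"
  by (simp add: cochain_inner_def tuples_0)

lemma cochain_inner_1:
  "cochain_inner ip M (Suc 0) \<phi> \<psi> =
     (\<Sum>b\<in>(SOME B. orthonormal_basis_of ip M B). ip (\<phi> [b]) (\<psi> [b]))"
proof -
  have "inj_on (\<lambda>b. [b]) S" for S :: "'a set" by (auto intro: inj_onI)
  then show ?thesis
    by (simp add: cochain_inner_def tuples_1 sum.reindex)
qed

lemma differential_0:
  "differential br M 0 \<phi> xs = (if xs \<in> tuples M (Suc 0) then br (xs ! 0) (\<phi> []) else 0)"
  by (auto simp: differential_def tuples_1 nths_Cons)

lemma cochains_0: "cochains M 0 = {\<phi>. \<forall>xs. xs \<noteq> [] \<longrightarrow> \<phi> xs = 0}"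
  by (auto simp: cochains_def tuples_0)

text \<open>The right-hand side satisfies the defining adjointness relation, and nondegeneracy makes it
  the only 0-cochain that does. This turns the description by \<open>THE\<close> and by an unspecified orthonormal
  basis into a formula.\<close>

lemma codifferential_0:
  fixes ip :: "'v::real_vector \<Rightarrow> 'v \<Rightarrow> real"
  assumes ip: "bilinear ip"
    and nondeg: "\<And>w. (\<And>v. ip v w = 0) \<Longrightarrow> w = 0"
    and B: "B = (SOME B. orthonormal_basis_of ip M B)" "orthonormal_basis_of ip M B"
    and adj: "\<And>b u v. b \<in> M \<Longrightarrow> ip (br b u) v = ip u (D b v)"
  shows "codifferential br ip M 0 \<psi> = (\<lambda>xs. if xs = [] then \<Sum>b\<in>B. D b (\<psi> [b]) else 0)"
proof -
  define \<eta>0 where "\<eta>0 = (\<lambda>xs::'v list. if xs = [] then \<Sum>b\<in>B. D b (\<psi> [b]) else 0)"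
  have BM: "B \<subseteq> M" and "finite B"
    using B(2) span_superset[of B] by (auto simp: orthonormal_basis_of_def)
  interpret r: linear "ip u" for u using ip by (simp add: bilinear_def)
  have dual: "cochain_inner ip M (Suc 0) (differential br M 0 \<phi>) \<psi> = ip (\<phi> []) (\<eta>0 [])" for \<phi>
  proof -
    have "cochain_inner ip M (Suc 0) (differential br M 0 \<phi>) \<psi> = (\<Sum>b\<in>B. ip (br b (\<phi> [])) (\<psi> [b]))"
      unfolding cochain_inner_1 B(1)[symmetric]
      by (rule sum.cong) (use BM in \<open>auto simp: differential_0 tuples_def\<close>)
    also have "\<dots> = (\<Sum>b\<in>B. ip (\<phi> []) (D b (\<psi> [b])))"
      by (rule sum.cong) (use BM adj in auto)
    also have "\<dots> = ip (\<phi> []) (\<eta>0 [])"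
      by (simp add: \<eta>0_def r.sum)
    finally show ?thesis .
  qed
  have "(THE \<eta>. \<eta> \<in> cochains M 0 \<and> (\<forall>\<phi>\<in>cochains M 0.
           cochain_inner ip M (Suc 0) (differential br M 0 \<phi>) \<psi> = cochain_inner ip M 0 \<phi> \<eta>)) = \<eta>0"
  proof (rule the_equality)
    show "\<eta>0 \<in> cochains M 0 \<and> (\<forall>\<phi>\<in>cochains M 0.
           cochain_inner ip M (Suc 0) (differential br M 0 \<phi>) \<psi> = cochain_inner ip M 0 \<phi> \<eta>0)"
      by (simp add: dual cochain_inner_0) (simp add: cochains_0 \<eta>0_def)
  next
    fix \<eta> assume \<eta>: "\<eta> \<in> cochains M 0 \<and> (\<forall>\<phi>\<in>cochains M 0.
           cochain_inner ip M (Suc 0) (differential br M 0 \<phi>) \<psi> = cochain_inner ip M 0 \<phi> \<eta>)"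
    have "ip v (\<eta> [] - \<eta>0 []) = 0" for v
    proof -
      have "(\<lambda>xs. if xs = [] then v else 0) \<in> cochains M 0"
        by (simp add: cochains_0)
      with \<eta> have "ip v (\<eta> []) = ip v (\<eta>0 [])"
        unfolding dual cochain_inner_0 by fastforce
      then show ?thesis by (simp add: r.diff)
    qed
    then have "\<eta> [] = \<eta>0 []" using nondeg[of "\<eta> [] - \<eta>0 []"] by simp
    then show "\<eta> = \<eta>0"
      using \<eta> by (auto simp: cochains_0 \<eta>0_def fun_eq_iff)
  qed
  then show ?thesis by (simp add: codifferential_def \<eta>0_def)
qed

text \<open>Invariance of the codifferential, tested on the rank-one cochains
  \<open>x \<mapsto> \<langle>x, b\<rangle> v\<close>. If the group element acts trivially on the quotient by
  \<open>nonneg_part V\<close>, it can be moved only through the values of a cochain, so it has to commute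
  with every metric adjoint \<open>D b\<close> of \<open>br b\<close>.\<close>

lemma admissible_commutes_with_adjoint:
  fixes ip :: "'v::real_normed_vector \<Rightarrow> 'v \<Rightarrow> real"
  assumes adm: "admissible_metric br V ip"
    and ip: "bilinear ip"
    and nondeg: "\<And>w. (\<And>v. ip v w = 0) \<Longrightarrow> w = 0"
    and M: "M = neg_part V" "\<exists>B. orthonormal_basis_of ip M B"
    and adj: "\<And>b u v. b \<in> M \<Longrightarrow> ip (br b u) v = ip u (D b v)"
    and D: "bilinear D"
    and A: "A \<in> adjoint_group br (nonneg_part V)" "linear A"
    and trivial: "\<And>x. x \<in> M \<Longrightarrow> proj_along M (nonneg_part V) (inv A x) = x"
    and b: "b \<in> M"
  shows "A (D b v) = D b (A v)"
proof -
  define B where "B = (SOME B. orthonormal_basis_of ip M B)"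
  have onb: "orthonormal_basis_of ip M B"
    unfolding B_def using M(2) by (rule someI_ex)
  have BM: "B \<subseteq> M" and fin: "finite B" and spanB: "span B = M"
    using onb span_superset[of B] by (auto simp: orthonormal_basis_of_def)
  interpret A: linear A by fact
  interpret Dl: linear "\<lambda>c. D c w" for w using D by (simp add: bilinear_def)
  interpret Dr: linear "D c" for c using D by (simp add: bilinear_def)
  have codiff: "codifferential br ip M 0 \<psi> = (\<lambda>xs. if xs = [] then \<Sum>b\<in>B. D b (\<psi> [b]) else 0)" for \<psi>
    by (rule codifferential_0[where ip = ip and D = D and M = M and br = br])
      (fact ip nondeg B_def onb adj)+
  have basis: "A (D b v) = D b (A v)" if b: "b \<in> B" for b
  proof -
    define \<psi> where "\<psi> = (\<lambda>xs. if xs \<in> tuples M (Suc 0) then ip (xs ! 0) b *\<^sub>R v else 0)"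
    have sM: "subspace M" using spanB subspace_span by metis
    have "\<psi> \<in> cochains M (Suc 0)"
      unfolding cochains_def \<psi>_def
      using sM by (auto simp: tuples_1 bilinear_ladd[OF ip] bilinear_lmul[OF ip] scaleR_add_left
          subspace_add subspace_scale)
    then have "codifferential br ip M 0 (cochain_action M (nonneg_part V) (Suc 0) A \<psi>) =
        cochain_action M (nonneg_part V) 0 A (codifferential br ip M 0 \<psi>)"
      using adm A(1) by (auto simp: admissible_metric_def Let_def M(1))
    from fun_cong[OF this, of "[]"]
    have "(\<Sum>c\<in>B. D c (cochain_action M (nonneg_part V) (Suc 0) A \<psi> [c])) = A (\<Sum>c\<in>B. D c (\<psi> [c]))"
      by (simp add: codiff cochain_action_def[of _ _ 0] tuples_0)
    moreover have "cochain_action M (nonneg_part V) (Suc 0) A \<psi> [c] = (if c = b then A v else 0)"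
      and "\<psi> [c] = (if c = b then v else 0)" if "c \<in> B" for c
      using that b BM onb
      by (auto simp: cochain_action_def \<psi>_def tuples_def trivial orthonormal_basis_of_def
          subset_iff A.zero)
    ultimately show ?thesis
      using b fin by (simp add: if_distrib[of "D _"] cong: if_cong)
  qed
  have "b \<in> span B" unfolding spanB by (rule b)
  then show ?thesis
    by (rule span_induct)
      (auto simp: subspace_def basis Dl.zero Dl.add Dl.scale A.zero A.add A.scale)
qed

section \<open>Exponentials of operators\<close>

lemma endo_exp_square_zero:
  assumes "\<And>x. A (A x) = 0" "A 0 = 0"
  shows "endo_exp A x = x + A x"
proof -
  have "(A ^^ n) x = 0" if "n \<notin> {0, 1}" for n
  proof -
    obtain m where "n = Suc (Suc m)"
      using \<open>n \<notin> {0, 1}\<close> by (metis insertCI not0_implies_Suc One_nat_def)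
    then show ?thesis by (simp add: assms(1))
  qed
  then have "(\<Sum>n. (A ^^ n) x /\<^sub>R fact n) = (\<Sum>n\<in>{0,1}. (A ^^ n) x /\<^sub>R fact n)"
    by (intro suminf_finite) auto
  then show ?thesis by (simp add: endo_exp_def)
qed

lemma funpow_scaleR_linear:
  fixes A :: "'v::real_vector \<Rightarrow> 'v"
  assumes "linear A"
  shows "((\<lambda>x. t *\<^sub>R A x) ^^ n) x = t ^ n *\<^sub>R (A ^^ n) x"
  by (induction n) (simp_all add: linear_scale[OF assms])

text \<open>Each coordinate is an everywhere convergent real power series in \<open>t\<close>, whose linear
  coefficient is its derivative at 0.\<close>

lemma endo_exp_has_derivative_0:
  fixes A :: "'a::euclidean_space \<Rightarrow> 'a"
  assumes A: "linear A"
  shows "((\<lambda>t. endo_exp (\<lambda>x. t *\<^sub>R A x) x) has_vector_derivative A x) (at 0)"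
proof -
  obtain K where K: "\<And>x. norm (A x) \<le> K * norm x" "K > 0"
    using linear_bounded_pos[OF A] by blast
  have pow: "norm ((A ^^ n) x) \<le> K ^ n * norm x" for n
  proof (induction n)
    case (Suc n)
    have "norm ((A ^^ Suc n) x) \<le> K * norm ((A ^^ n) x)" using K(1) by simp
    also have "\<dots> \<le> K * (K ^ n * norm x)" using Suc K(2) by (intro mult_left_mono) auto
    finally show ?case by (simp add: mult.assoc)
  qed simp
  have summable: "summable (\<lambda>n. (t ^ n *\<^sub>R (A ^^ n) x) /\<^sub>R fact n)" for t
  proof (rule summable_comparison_test')
    show "summable (\<lambda>n. norm x * ((\<bar>t\<bar> * K) ^ n /\<^sub>R fact n))"
      by (intro summable_mult summable_exp_generic)
    show "norm ((t ^ n *\<^sub>R (A ^^ n) x) /\<^sub>R fact n) \<le> norm x * ((\<bar>t\<bar> * K) ^ n /\<^sub>R fact n)" for n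
      using mult_left_mono[OF pow[of n], of "\<bar>t\<bar> ^ n / fact n"]
      by (simp add: power_abs power_mult_distrib field_simps)
  qed
  have coord: "endo_exp (\<lambda>x. t *\<^sub>R A x) x \<bullet> i = (\<Sum>n. ((A ^^ n) x \<bullet> i / fact n) * t ^ n)"
    and coord_summable: "summable (\<lambda>n. ((A ^^ n) x \<bullet> i / fact n) * t ^ n)" for t and i :: 'a
  proof -
    have "((t ^ n *\<^sub>R (A ^^ n) x) /\<^sub>R fact n) \<bullet> i = ((A ^^ n) x \<bullet> i / fact n) * t ^ n" for n
      by (simp add: divide_inverse)
    then show "endo_exp (\<lambda>x. t *\<^sub>R A x) x \<bullet> i = (\<Sum>n. ((A ^^ n) x \<bullet> i / fact n) * t ^ n)"
      and "summable (\<lambda>n. ((A ^^ n) x \<bullet> i / fact n) * t ^ n)"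
      using bounded_linear.suminf[OF bounded_linear_inner_left[of i] summable[of t]]
        bounded_linear.summable[OF bounded_linear_inner_left[of i] summable[of t]]
      unfolding endo_exp_def funpow_scaleR_linear[OF A] by simp_all
  qed
  have "((\<lambda>t. endo_exp (\<lambda>x. t *\<^sub>R A x) x \<bullet> i) has_field_derivative A x \<bullet> i) (at 0)" for i
    unfolding coord
    using termdiffs_strong_converges_everywhere[OF coord_summable, of i 0]
    unfolding powser_zero by (simp add: diffs_def)
  then show ?thesis
    unfolding has_vector_derivative_def
    by (subst has_derivative_componentwise_within)
      (simp add: has_field_derivative_def mult.commute[of _ "A x \<bullet> _"])
qed

text \<open>Invariance is differentiated along the one-parameter group of \<open>X\<close> at \<open>t = 0\<close>.\<close>

lemma Ad_invariant_metric_imp_skew: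
  fixes br :: "'a::euclidean_space \<Rightarrow> 'a \<Rightarrow> 'a"
  assumes inv: "Ad_invariant_metric br S (\<bullet>)" and br: "bilinear br"
    and S: "subspace S" "X \<in> S"
  shows "br X x \<bullet> y = - (x \<bullet> br X y)"
proof -
  define g where "g = (\<lambda>x t. endo_exp (\<lambda>x. t *\<^sub>R br X x) x)"
  have lin: "linear (br X)" using br by (simp add: bilinear_def)
  have "g x t \<bullet> g y t = x \<bullet> y" for t
  proof -
    have "br (t *\<^sub>R X) = (\<lambda>x. t *\<^sub>R br X x)"
      by (rule ext) (simp add: bilinear_lmul[OF br])
    moreover have "endo_exp (br (t *\<^sub>R X)) \<circ> id \<in> adjoint_group br S"
      by (intro adjoint_group.intros subspace_scale S)
    ultimately show ?thesis
      using inv by (auto simp: Ad_invariant_metric_def g_def)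
  qed
  moreover have "((\<lambda>t. g x t \<bullet> g y t) has_derivative
      (\<lambda>t. g x 0 \<bullet> (t *\<^sub>R br X y) + (t *\<^sub>R br X x) \<bullet> g y 0)) (at 0)"
    using endo_exp_has_derivative_0[OF lin] unfolding g_def has_vector_derivative_def
    by (intro has_derivative_inner)
  ultimately have "((\<lambda>t. x \<bullet> y) has_derivative
      (\<lambda>t. g x 0 \<bullet> (t *\<^sub>R br X y) + (t *\<^sub>R br X x) \<bullet> g y 0)) (at (0::real))"
    by simp
  then have "(\<lambda>t::real. g x 0 \<bullet> (t *\<^sub>R br X y) + (t *\<^sub>R br X x) \<bullet> g y 0) = (\<lambda>t. 0)"
    using has_derivative_unique has_derivative_const by blast
  then have "g x 0 \<bullet> br X y + br X x \<bullet> g y 0 = 0"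
    by (metis scaleR_one)
  moreover have "g z 0 = z" for z
    by (simp add: g_def endo_exp_square_zero)
  ultimately show ?thesis by simp
qed

section \<open>The cotangent Lie algebra in metric terms\<close>

abbreviation flat :: "'a::euclidean_space \<Rightarrow> 'a dual" where
  "flat \<equiv> blinfun_inner_right"

definition sharp :: "'a::euclidean_space dual \<Rightarrow> 'a" where
  "sharp \<alpha> = (\<Sum>b\<in>Basis. blinfun_apply \<alpha> b *\<^sub>R b)"

lemma inner_sharp: "sharp \<alpha> \<bullet> x = blinfun_apply \<alpha> x"
proof -
  interpret linear "blinfun_apply \<alpha>" by (rule bounded_linear.linear[OF blinfun.bounded_linear_right])
  have "blinfun_apply \<alpha> x = blinfun_apply \<alpha> (\<Sum>b\<in>Basis. (x \<bullet> b) *\<^sub>R b)"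
    by (simp add: euclidean_representation)
  also have "\<dots> = sharp \<alpha> \<bullet> x"
    by (simp add: sum scale sharp_def inner_sum_left inner_commute[of x] mult.commute)
  finally show ?thesis by simp
qed

lemma flat_sharp [simp]: "flat (sharp \<alpha>) = \<alpha>"
  by (rule blinfun_eqI) (simp add: inner_sharp)

lemma sharp_flat [simp]: "sharp (flat a) = a"
  by (metis euclidean_eqI inner_sharp blinfun_inner_right.rep_eq)

lemma linear_flat: "linear flat"
  by (rule bounded_linear.linear[OF bounded_linear_blinfun_inner_right])

lemma linear_sharp: "linear sharp"
  by (rule linearI)
    (simp_all add: sharp_def blinfun.add_left blinfun.scaleR_left scaleR_add_left sum.distrib
      scaleR_sum_right)

lemma dual_inner_sharp: "dual_inner \<alpha> \<beta> = sharp \<alpha> \<bullet> sharp \<beta>"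
  by (subst euclidean_inner) (simp add: dual_inner_def inner_sharp)

lemma bilinear_adjoint:
  fixes br :: "'a::euclidean_space \<Rightarrow> 'a \<Rightarrow> 'a"
  assumes "bilinear br"
  shows "bilinear (\<lambda>e. adjoint (br e))"
proof -
  have lin: "linear (br e)" for e using assms by (simp add: bilinear_def)
  have "linear (\<lambda>e. adjoint (br e) x)" for x
    by (rule linearI; rule vector_eq_ldot[THEN iffD1])
      (simp_all add: inner_add_right adjoint_works[OF lin] bilinear_ladd[OF assms]
        bilinear_lmul[OF assms] inner_add_left)
  then show ?thesis
    by (simp add: bilinear_def adjoint_linear[OF lin])
qed

lemma coadjoint_flat:
  fixes br :: "'a::euclidean_space \<Rightarrow> 'a \<Rightarrow> 'a"
  assumes "bilinear br"
  shows "coadjoint br X (flat a) = - flat (adjoint (br X) a)"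
proof -
  have lin: "linear (br X)" using assms by (simp add: bilinear_def)
  have "(\<lambda>Y. - (a \<bullet> br X Y)) = blinfun_apply (- flat (adjoint (br X) a))"
    using adjoint_works[OF lin, of _ a] by (auto simp: blinfun.minus_left inner_commute)
  then show ?thesis
    by (simp add: coadjoint_def blinfun_apply_inverse)
qed

lemma cot_bracket_flat:
  fixes br :: "'a::euclidean_space \<Rightarrow> 'a \<Rightarrow> 'a"
  assumes "bilinear br"
  shows "cot_bracket br (x, flat a) (y, flat b) =
    (br x y, flat (adjoint (br y) a - adjoint (br x) b))"
  by (simp add: cot_bracket_def coadjoint_flat[OF assms] linear_diff[OF linear_flat])

text \<open>The metric adjoint, on the cotangent Lie algebra, of \<open>cot_bracket br u\<close> for \<open>u\<close> in the
  subalgebra of pairs with second component 0. On the dual summand it is minus the bracket because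
  the coadjoint action is minus a transpose.\<close>

definition cot_adjoint ::
    "('a::euclidean_space \<Rightarrow> 'a \<Rightarrow> 'a) \<Rightarrow> 'a \<times> 'a dual \<Rightarrow> 'a \<times> 'a dual \<Rightarrow> 'a \<times> 'a dual" where
  "cot_adjoint br u v =
     (adjoint (br (fst u)) (fst v), - flat (br (fst u) (sharp (snd v))))"

lemma cot_adjoint:
  fixes br :: "'a::euclidean_space \<Rightarrow> 'a \<Rightarrow> 'a"
  assumes "bilinear br"
  shows "cot_inner (cot_bracket br (e, 0) u) v = cot_inner u (cot_adjoint br (e, 0) v)"
proof -
  obtain x a y b where uv: "u = (x, flat a)" "v = (y, flat b)"
    by (metis flat_sharp prod.exhaust)
  have lin: "linear (br z)" for z using assms by (simp add: bilinear_def)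
  have 0: "adjoint (br z) 0 = 0" for z
    using linear_0[OF adjoint_linear[OF lin]] .
  have "cot_bracket br (e, flat 0) (x, flat a) = (br e x, flat (- adjoint (br e) a))"
    by (simp add: cot_bracket_flat[OF assms] 0)
  then show ?thesis
    using adjoint_works[OF lin, of x e y] adjoint_works[OF lin, of b e a]
    by (simp add: uv cot_inner_def dual_inner_sharp cot_adjoint_def linear_0[OF linear_flat]
        linear_neg[OF linear_flat, symmetric] inner_commute)
qed

lemma bilinear_cot_adjoint:
  fixes br :: "'a::euclidean_space \<Rightarrow> 'a \<Rightarrow> 'a"
  assumes "bilinear br"
  shows "bilinear (cot_adjoint br)"
  using bilinear_ladd[OF bilinear_adjoint[OF assms]] bilinear_radd[OF bilinear_adjoint[OF assms]]
    bilinear_lmul[OF bilinear_adjoint[OF assms]] bilinear_rmul[OF bilinear_adjoint[OF assms]]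
  by (auto simp: bilinear_def linear_iff cot_adjoint_def linear_add[OF linear_flat]
    linear_scale[OF linear_flat] linear_add[OF linear_sharp] linear_scale[OF linear_sharp]
    bilinear_ladd[OF assms] bilinear_radd[OF assms] bilinear_lmul[OF assms] bilinear_rmul[OF assms])

lemma bilinear_cot_inner: "bilinear cot_inner"
  by (auto simp: bilinear_def linear_iff cot_inner_def dual_inner_sharp inner_add_left
    inner_add_right linear_add[OF linear_sharp] linear_scale[OF linear_sharp] distrib_left)

lemma cot_inner_nondegenerate:
  assumes "\<And>v. cot_inner v w = 0"
  shows "w = 0"
proof -
  have "fst w \<bullet> fst w + sharp (snd w) \<bullet> sharp (snd w) = 0"
    using assms[of w] by (simp add: cot_inner_def dual_inner_sharp)
  then have "fst w = 0" "sharp (snd w) = 0"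
    by (smt (verit) inner_ge_zero inner_eq_zero_iff)+
  then show ?thesis
    using flat_sharp[of "snd w"] by (simp add: prod_eq_iff linear_0[OF linear_flat])
qed

section \<open>Graded components\<close>

lemma fundamental_gradation_decomposition:
  assumes "fundamental_gradation br k V"
  obtains f where "\<And>i. f i \<in> V i" "x = (\<Sum>i = - int k..0. f i)"
  using assms unfolding fundamental_gradation_def by metis

lemma orthogonal_to_components_imp_zero:
  fixes x :: "'a::euclidean_space"
  assumes "fundamental_gradation br k V" and "\<And>i w. w \<in> V i \<Longrightarrow> x \<bullet> w = 0"
  shows "x = 0"
proof -
  obtain f where f: "\<And>i. f i \<in> V i" and x: "x = (\<Sum>i = - int k..0. f i)"
    using fundamental_gradation_decomposition[OF assms(1)] by blast
  have "x \<bullet> (\<Sum>i = - int k..0. f i) = 0"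
    using assms(2)[OF f] by (simp add: inner_sum_right)
  then have "x \<bullet> x = 0" by (simp only: x[symmetric])
  then show ?thesis by simp
qed

lemma orthogonal_to_other_components_imp_mem:
  fixes x :: "'a::euclidean_space"
  assumes fg: "fundamental_gradation br k V" and orth: "adapted_metric (\<bullet>) V"
    and x: "\<And>j w. j \<noteq> i \<Longrightarrow> w \<in> V j \<Longrightarrow> x \<bullet> w = 0"
  shows "x \<in> V i"
proof -
  have sub: "subspace (V j)" for j using fg by (simp add: fundamental_gradation_def)
  obtain f where f: "\<And>i. f i \<in> V i" "x = (\<Sum>i = - int k..0. f i)"
    using fundamental_gradation_decomposition[OF fg] by blast
  have "f j = 0" if "j \<noteq> i" "j \<in> {- int k..0}" for j
  proof -
    have "x \<bullet> f j = (\<Sum>l = - int k..0. if l = j then f j \<bullet> f j else 0)"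
      unfolding f(2) inner_sum_left
      by (rule sum.cong) (use f(1) orth in \<open>auto simp: adapted_metric_def\<close>)
    then show ?thesis using x[OF that(1) f(1)] that(2) by simp
  qed
  then have "(\<Sum>l = - int k..0. f l) \<in> V i"
    by (intro subspace_sum sub) (metis f(1) subspace_0 sub)
  then show ?thesis using f(2) by simp
qed

lemma neg_part_cot_gradation: "neg_part (cot_gradation V) = neg_part V \<times> {0}"
proof -
  have lin: "linear (\<lambda>x::'a. (x, 0::'a dual))" by (rule linearI) auto
  have "(\<Union>i\<in>{..<0}. cot_gradation V i) = (\<lambda>x. (x, 0)) ` (\<Union>i\<in>{..<0}. V i)"
    by (auto simp: cot_gradation_def)
  then show ?thesis
    unfolding neg_part_def by (auto simp: span_linear_image[OF lin])
qed

text \<open>A functional is split into homogeneous ones by splitting the vector that represents it. By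
  orthogonality of the components, the functional of a vector in \<open>V i\<close> vanishes on the others.\<close>

lemma dual_subset_nonneg_part:
  fixes V :: "int \<Rightarrow> 'a::euclidean_space set"
  assumes fg: "fundamental_gradation br k V" and orth: "adapted_metric (\<bullet>) V"
  shows "(0, \<alpha>) \<in> nonneg_part (cot_gradation V)"
proof -
  have sub: "subspace (V j)" for j using fg by (simp add: fundamental_gradation_def)
  obtain f where f: "\<And>i. f i \<in> V i" "sharp \<alpha> = (\<Sum>i = - int k..0. f i)"
    using fundamental_gradation_decomposition[OF fg] by blast
  have "(0, flat (f i)) \<in> cot_gradation V (- i)" if "i \<le> 0" for i
  proof -
    have "f i \<bullet> w = 0" if "j \<noteq> i" "w \<in> V j" for j w
      using orth f(1)[of i] that unfolding adapted_metric_def by metis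
    then have "flat (f i) \<in> dual_component V i"
      by (simp add: dual_component_def)
    then show ?thesis
      using that subspace_0[OF sub] by (auto simp: cot_gradation_def)
  qed
  then have "(\<Sum>i = - int k..0. (0::'a, flat (f i))) \<in> nonneg_part (cot_gradation V)"
    unfolding nonneg_part_def by (intro span_sum span_base) force
  moreover have "(\<Sum>i = - int k..0. (0::'a, flat (f i))) = (0, flat (sharp \<alpha>))"
    by (simp add: f(2) linear_sum[OF linear_flat] sum_prod)
  ultimately show ?thesis by simp
qed

lemma nonneg_part_cot_gradation_subset:
  assumes "subspace (V 0)"
  shows "nonneg_part (cot_gradation V) \<subseteq> V 0 \<times> UNIV"
  unfolding nonneg_part_def
  by (rule span_minimal)
    (use assms in \<open>auto simp: cot_gradation_def subspace_Times subspace_0 split: if_splits\<close>)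

section \<open>The algebraic identity forced by admissibility\<close>

text \<open>The unipotent element \<open>A = 1 + ad \<alpha>\<close> has to commute with the adjoint of \<open>ad (e, 0)\<close>. Evaluating
  this at \<open>(x, 0)\<close>, with \<open>\<alpha>\<close> represented by the vector \<open>a\<close>, and pairing with \<open>y\<close> gives the inner
  product of the identity with \<open>a\<close>.\<close>

lemma admissible_imp_adjoint_identity:
  fixes br :: "'a::euclidean_space \<Rightarrow> 'a \<Rightarrow> 'a"
  assumes br: "bilinear br"
    and fg: "fundamental_gradation br k V" and orth: "adapted_metric (\<bullet>) V"
    and adm: "admissible_metric (cot_bracket br) (cot_gradation V) cot_inner"
    and e: "e \<in> neg_part V"
  shows "br (adjoint (br e) x) y + br x (adjoint (br e) y) = 0"
proof -
  let ?h = "cot_bracket br" and ?M = "neg_part (cot_gradation V)"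
    and ?N = "nonneg_part (cot_gradation V)"
  have sub: "subspace (V j)" for j using fg by (simp add: fundamental_gradation_def)
  have lin: "linear (br z)" for z using br by (simp add: bilinear_def)
  note bladj = bilinear_adjoint[OF br]
  have M: "?M = neg_part V \<times> {0}" by (rule neg_part_cot_gradation)
  have ex: "\<exists>B. orthonormal_basis_of cot_inner ?M B"
  proof -
    have "subspace (neg_part V)" by (simp add: neg_part_def)
    then obtain B where B: "B \<subseteq> neg_part V" "pairwise orthogonal B"
      "\<And>x. x \<in> B \<Longrightarrow> norm x = 1" "independent B" "card B = dim (neg_part V)" "span B = neg_part V"
      using orthonormal_basis_subspace by blast
    have lin0: "linear (\<lambda>x::'a. (x, 0::'a dual))" by (rule linearI) auto
    have "orthonormal_basis_of cot_inner ?M ((\<lambda>x. (x, 0)) ` B)"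
      using B(2,3) independent_imp_finite[OF B(4)]
      by (auto simp: orthonormal_basis_of_def M span_linear_image[OF lin0] B(6) cot_inner_def
          dual_inner_def pairwise_def orthogonal_def norm_eq_1)
    then show ?thesis by blast
  qed
  have adj: "cot_inner (?h b u) v = cot_inner u (cot_adjoint br b v)" if "b \<in> ?M" for b u v
  proof -
    from that obtain z where "b = (z, 0)" unfolding M by auto
    then show ?thesis using cot_adjoint[OF br] by simp
  qed
  have disjoint: "z = 0" if "z \<in> neg_part V" "z \<in> V 0" for z
  proof -
    have "z \<bullet> w = 0" if "w \<in> V i" "i < 0" for i w
      using that \<open>z \<in> V 0\<close> orth unfolding adapted_metric_def by (metis less_irrefl)
    then have "neg_part V \<subseteq> {w. z \<bullet> w = 0}"
      unfolding neg_part_def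
      by (intro span_minimal) (auto simp: subspace_def inner_add_right)
    then show ?thesis using that(1) by auto
  qed
  have commute: "a \<bullet> (br (adjoint (br e) x) y + br x (adjoint (br e) y)) = 0" for a
  proof -
    define A where "A = (\<lambda>v. v + ?h (0, flat a) v)"
    have h_flat: "?h (0, flat a) (z, \<beta>) = (0, flat (adjoint (br z) a))" for z \<beta>
      using cot_bracket_flat[OF br, of 0 a z "sharp \<beta>"]
      by (simp add: bilinear_lzero[OF br] bilinear_lzero[OF bladj])
    have linA: "linear A"
      by (rule linearI)
        (auto simp: A_def h_flat bilinear_ladd[OF bladj] bilinear_lmul[OF bladj]
          linear_add[OF linear_flat] linear_scale[OF linear_flat] scaleR_add_right)
    have sq: "?h (0, flat a) (?h (0, flat a) v) = 0" and h0: "?h (0, flat a) 0 = 0" for v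
      by (cases v; simp add: h_flat bilinear_lzero[OF bladj] linear_0[OF linear_flat] zero_prod_def)+
    have "endo_exp (?h (0, flat a)) = A"
      unfolding A_def using endo_exp_square_zero[of "?h (0, flat a)", OF sq h0] by blast
    then have A: "A \<in> adjoint_group ?h ?N"
      using adjoint_group_step[OF adjoint_group_id dual_subset_nonneg_part[OF fg orth, of "flat a"], of ?h]
      by simp
    have invA: "inv A u = u - ?h (0, flat a) u" for u
    proof (rule inv_f_eq)
      show "inj A"
      proof (rule injI)
        fix u v assume "A u = A v"
        then show "u = v"
          by (cases u; cases v) (auto simp: A_def h_flat)
      qed
      show "A (u - ?h (0, flat a) u) = u"
        by (cases u) (simp add: A_def h_flat)
    qed
    \<comment> \<open>\<open>inv A\<close> moves a negative vector only by a functional, which projects to 0.\<close>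
    have trivial: "proj_along ?M ?N (inv A u) = u" if "u \<in> ?M" for u
      unfolding proj_along_def
    proof (rule the_equality)
      obtain z where z: "u = (z, 0)" "z \<in> neg_part V" using \<open>u \<in> ?M\<close> M by auto
      show "u \<in> ?M \<and> inv A u - u \<in> ?N"
        using that dual_subset_nonneg_part[OF fg orth] by (simp add: invA z h_flat)
      fix u' assume u': "u' \<in> ?M \<and> inv A u - u' \<in> ?N"
      then obtain z' where z': "u' = (z', 0)" "z' \<in> neg_part V" using M by auto
      have "inv A u - u' \<in> V 0 \<times> UNIV"
        using u' nonneg_part_cot_gradation_subset[of V, OF sub] by blast
      then have "z - z' \<in> V 0" by (auto simp: invA z z' h_flat)
      moreover have "z - z' \<in> neg_part V"
        using z(2) z'(2) unfolding neg_part_def by (rule span_diff)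
      ultimately show "u' = u" using disjoint z z' by force
    qed
    have "A (cot_adjoint br (e, 0) (x, 0)) = cot_adjoint br (e, 0) (A (x, 0))"
      by (rule admissible_commutes_with_adjoint[OF adm bilinear_cot_inner
            cot_inner_nondegenerate refl ex adj bilinear_cot_adjoint[OF br] A linA trivial])
        (simp_all add: M e)
    then have "flat (adjoint (br (adjoint (br e) x)) a) = flat (- br e (adjoint (br x) a))"
      by (simp add: A_def cot_adjoint_def h_flat bilinear_rzero[OF br] linear_neg[OF linear_flat]
          linear_0[OF linear_sharp] linear_0[OF linear_flat])
    then have "adjoint (br (adjoint (br e) x)) a = - br e (adjoint (br x) a)"
      by (metis sharp_flat)
    then have "y \<bullet> adjoint (br (adjoint (br e) x)) a = - (y \<bullet> br e (adjoint (br x) a))"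
      by simp
    moreover have "y \<bullet> br e (adjoint (br x) a) = br x (adjoint (br e) y) \<bullet> a"
      using adjoint_works[OF lin, of "adjoint (br x) a" e y] adjoint_works[OF lin, of "adjoint (br e) y" x a]
      by (simp add: inner_commute)
    ultimately show ?thesis
      using adjoint_works[OF lin, of y _ a] by (simp add: inner_add_right inner_commute)
  qed
  then show ?thesis using inner_eq_zero_iff by blast
qed

section \<open>The degree-zero part\<close>

theorem corollary2:
  fixes br :: "'a::euclidean_space \<Rightarrow> 'a \<Rightarrow> 'a"
    and k :: nat
    and V :: "int \<Rightarrow> 'a set"
  assumes "lie_algebra br"
    and "fundamental_gradation br k V"
    and "adapted_metric (\<bullet>) V"
    and "admissible_metric (cot_bracket br) (cot_gradation V) cot_inner"
  shows "(\<forall>X\<in>V 0. \<forall>Y\<in>V 0. br X Y = 0) \<and> \<not> Ad_invariant_metric br (V 0) (\<bullet>)"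
proof -
  note fg = assms(2) and orth = assms(3)
  have br: "bilinear br" and anti0: "\<And>x. br x x = 0"
    using assms(1) by (auto simp: lie_algebra_def)
  have lin: "linear (br z)" for z using br by (simp add: bilinear_def)
  have anti: "br x y = - br y x" for x y
  proof -
    have "br (x + y) (x + y) = (br x x + br y x) + (br x y + br y y)"
      by (simp only: bilinear_ladd[OF br] bilinear_radd[OF br])
    then have "br x y + br y x = 0" by (simp add: anti0 add.commute)
    then show ?thesis by (simp only: eq_neg_iff_add_eq_0)
  qed
  have sub: "subspace (V j)" and grade: "\<And>i j x y. x \<in> V i \<Longrightarrow> y \<in> V j \<Longrightarrow> br x y \<in> V (i + j)"
    and V1: "V 1 = {0}" and V0: "V 0 \<noteq> {0}"
    and faithful: "\<And>x. x \<in> V 0 \<Longrightarrow> (\<And>y. y \<in> V (-1) \<Longrightarrow> br x y = 0) \<Longrightarrow> x = 0" for j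
    using fg unfolding fundamental_gradation_def by auto
  have perp: "x \<bullet> y = 0" if "x \<in> V i" "y \<in> V j" "i \<noteq> j" for x y i j
    using that orth by (auto simp: adapted_metric_def)
  define T where "T = (\<lambda>e. adjoint (br e))"
  have T: "T e x \<bullet> w = x \<bullet> br e w" for e x w
    using adjoint_works[OF lin, of w e x] by (simp add: T_def inner_commute)
  have identity: "br (T e x) y = - br x (T e y)" if "e \<in> V (-1)" for e x y
  proof -
    have "e \<in> neg_part V" unfolding neg_part_def using that by (intro span_base) force
    then show ?thesis
      using admissible_imp_adjoint_identity[OF br fg orth assms(4), of e x y]
      by (simp add: T_def eq_neg_iff_add_eq_0)
  qed
  \<comment> \<open>\<open>T e x\<close> has degree 1 for \<open>x\<close> of degree 0, and there is nothing in degree 1.\<close>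
  have T_V0: "T e x = 0" if e: "e \<in> V (-1)" and x: "x \<in> V 0" for e x
  proof (rule orthogonal_to_components_imp_zero[OF fg])
    fix i w assume w: "w \<in> V i"
    show "T e x \<bullet> w = 0"
    proof (cases "i = 1")
      case True
      then show ?thesis using w V1 by simp
    next
      case False
      then show ?thesis unfolding T using perp[OF x grade[OF e w]] by simp
    qed
  qed
  have T_mem: "T e x \<in> V 0" if e: "e \<in> V (-1)" and x: "x \<in> V (-1)" for e x
  proof (rule orthogonal_to_other_components_imp_mem[OF fg orth])
    fix j w assume "j \<noteq> 0" and w: "w \<in> V j"
    then show "T e x \<bullet> w = 0" unfolding T using perp[OF x grade[OF e w]] by simp
  qed
  \<comment> \<open>A part of \<open>V 0\<close> orthogonal to \<open>S\<close> would annihilate \<open>V (-1)\<close>, so faithfulness forces \<open>S\<close> to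
    span \<open>V 0\<close>.\<close>
  define S where "S = {T e x | e x. e \<in> V (-1) \<and> x \<in> V (-1)}"
  have "V 0 \<subseteq> span S"
  proof
    fix Y assume Y: "Y \<in> V 0"
    obtain s z where s: "s \<in> span S" and z: "\<And>w. w \<in> span S \<Longrightarrow> orthogonal z w" and Ysz: "Y = s + z"
      using orthogonal_subspace_decomp_exists[of S Y] by blast
    have "span S \<subseteq> V 0" using T_mem by (intro span_minimal sub) (auto simp: S_def)
    then have z0: "z \<in> V 0" using s Y Ysz subspace_diff[OF sub, of Y 0 s] by auto
    have "br z e = 0" if e: "e \<in> V (-1)" for e
    proof -
      \<comment> \<open>\<open>z\<close> is tested against \<open>T e\<close> of \<open>[e, z]\<close>, so that the pairing is a squared norm.\<close>
      have "br e z \<in> V (-1)" using grade[OF e z0] by simp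
      then have "T e (br e z) \<in> span S" using e by (auto simp: S_def intro!: span_base)
      then have "T e (br e z) \<bullet> z = 0" using z by (metis orthogonal_def inner_commute)
      then show ?thesis using anti[of z e] by (simp add: T)
    qed
    then have "z = 0" using faithful z0 by blast
    then show "Y \<in> span S" using s Ysz by simp
  qed
  moreover have "br X Y = 0" if X: "X \<in> V 0" and "Y \<in> span S" for X Y
    using that(2)
  proof (rule span_induct)
    show "subspace {Y. br X Y = 0}"
      by (auto simp: subspace_def bilinear_rzero[OF br] bilinear_radd[OF br] bilinear_rmul[OF br])
    fix Y assume "Y \<in> S"
    then obtain e x where e: "e \<in> V (-1)" and "Y = T e x" by (auto simp: S_def)
    then show "br X Y = 0"
      using identity[OF e, of X x] T_V0[OF e X] by (simp add: bilinear_lzero[OF br])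
  qed
  ultimately have abelian: "\<forall>X\<in>V 0. \<forall>Y\<in>V 0. br X Y = 0" by blast
  have "\<not> Ad_invariant_metric br (V 0) (\<bullet>)"
  proof
    assume "Ad_invariant_metric br (V 0) (\<bullet>)"
    then have skew: "br W x \<bullet> y = - (x \<bullet> br W y)" if "W \<in> V 0" for W x y
      using Ad_invariant_metric_imp_skew br sub that by blast
    have T_anti: "T e x = - T x e" if e: "e \<in> V (-1)" and x: "x \<in> V (-1)" for e x
    proof -
      have "T e x + T x e = 0"
      proof (rule orthogonal_to_components_imp_zero[OF fg])
        fix i w assume w: "w \<in> V i"
        show "(T e x + T x e) \<bullet> w = 0"
        proof (cases "i = 0")
          case True
          then have "x \<bullet> br w e = - (e \<bullet> br w x)"
            using skew[of w x e] w by (simp add: inner_commute)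
          then show ?thesis
            using anti[of e w] anti[of x w] by (simp add: inner_add_left T)
        next
          case False
          then show ?thesis
            using perp[OF T_mem[OF e x] w] perp[OF T_mem[OF x e] w] by (simp add: inner_add_left)
        qed
      qed
      then show ?thesis by (simp add: eq_neg_iff_add_eq_0)
    qed
    \<comment> \<open>A trilinear map antisymmetric in the first two arguments and symmetric in the last two
      vanishes: alternating the two swaps three times each returns to the start with opposite sign.\<close>
    have T_zero: "T e x = 0" if e: "e \<in> V (-1)" and x: "x \<in> V (-1)" for e x
    proof (rule faithful[OF T_mem[OF e x]])
      fix y assume y: "y \<in> V (-1)"
      have sym: "br (T a b) c = br (T a c) b" if "a \<in> V (-1)" for a b c
        using identity[OF that, of b c] anti[of b "T a c"] by simp
      have alt: "br (T a b) c = - br (T b a) c" if "a \<in> V (-1)" "b \<in> V (-1)" for a b c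
        using T_anti[OF that] by (simp add: bilinear_lneg[OF br])
      have "br (T e x) y = - br (T x e) y" using alt e x by blast
      also have "\<dots> = - br (T x y) e" using sym[OF x, of e y] by simp
      also have "\<dots> = br (T y x) e" using alt[OF x y, of e] by simp
      also have "\<dots> = br (T y e) x" using sym[OF y] by blast
      also have "\<dots> = - br (T e y) x" using alt[OF y e] by blast
      also have "\<dots> = - br (T e x) y" using sym[OF e, of x y] by simp
      finally have "2 *\<^sub>R br (T e x) y = 0"
        unfolding scaleR_2 by (simp only: eq_neg_iff_add_eq_0)
      then show "br (T e x) y = 0" by simp
    qed
    have "W = 0" if W: "W \<in> V 0" for W
    proof (rule faithful[OF W])
      fix e assume e: "e \<in> V (-1)"
      have "br e W \<in> V (-1)" using grade[OF e W] by simp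
      \<comment> \<open>\<open>T e\<close> applied to \<open>[e, W]\<close> itself, paired with \<open>W\<close>, yields the squared norm of \<open>[e, W]\<close>.\<close>
      then have "br e W \<bullet> br e W = 0" using T[of e "br e W" W] T_zero[OF e] by simp
      then show "br W e = 0" using anti[of W e] by simp
    qed
    then show False using V0 subspace_0[OF sub] by blast
  qed
  with abelian show ?thesis by blast
qed

end
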